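(* Let $f$ and $g$ be two homogeneous polynomials of positive degree in $\mathbb{C}[z_1,z_2]$. Then, for every sufficiently small $\varepsilon>0$, the singular point set of the Milnor fibration product map $\Phi:S_\varepsilon\setminus K_{fg}\to T^2$ associated with $f$ and $g$ either consists of at most $\deg f+\deg g-2$ circle components, or is the whole of $S_\varepsilon\setminus K_{fg}$.
   Context: $S_\varepsilon=\{z\in\mathbb{C}^2\mid \|z\|=\varepsilon\}$ and $K_{fg}=\{z\in S_\varepsilon\mid f(z)g(z)=0\}$. The Milnor fibration product map associated with $f,g$ is the $C^\infty$ map $\Phi:S_\varepsilon\setminus K_{fg}\to S^1\times S^1=T^2$, $\Phi(z)=\left(\frac{f(z)}{|f(z)|},\frac{g(z)}{|g(z)|}\right)$. A point $p$ is a singular point of $\Phi$ if $\mathrm{rank}\,d\Phi_p<2$. The singular point set is the set of all singular points of $\Phi$; "consists of at most $N$ circle components" means it is a disjoint union of at most $N$ (possibly zero) circles, which are its connected components. "For every sufficiently small $\varepsilon>0$" means: there is $\varepsilon_0>0$ (depending on $f,g$) such that the assertion holds for all $0<\varepsilon\le\varepsilon_0$. *)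

theory Defs
  imports "HOL-Analysis.Analysis" "HOL-Computational_Algebra.Polynomial"
begin

text \<open>
  The ring \<open>\<complex>[z\<^sub>1, z\<^sub>2]\<close> is rendered as \<open>\<complex>[z\<^sub>1][z\<^sub>2]\<close>, the type \<^typ>\<open>complex poly poly\<close>:
  \<^term>\<open>coeff (coeff p j) i\<close> is the coefficient of \<open>z\<^sub>1 ^ i * z\<^sub>2 ^ j\<close>.
\<close>

definition eval2 :: "complex poly poly \<Rightarrow> complex \<times> complex \<Rightarrow> complex" where
  "eval2 p z = poly (poly p [:snd z:]) (fst z)"

text \<open>The zero polynomial gets total degree 0, so positive total degree entails being nonzero.\<close>

definition total_degree :: "complex poly poly \<Rightarrow> nat" where
  "total_degree p = Max (insert 0 {i + j | i j. coeff (coeff p j) i \<noteq> 0})"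

definition homogeneous :: "complex poly poly \<Rightarrow> bool" where
  "homogeneous p \<longleftrightarrow> (\<exists>d. \<forall>i j. coeff (coeff p j) i \<noteq> 0 \<longrightarrow> i + j = d)"

text \<open>
  The norm of \<^typ>\<open>complex \<times> complex\<close> is the Euclidean (Hermitian) norm, and the inner product
  \<open>\<bullet>\<close> on it is the real one, i.e. the real part of the Hermitian product.
\<close>

definition link :: "complex poly poly \<Rightarrow> complex poly poly \<Rightarrow> real \<Rightarrow> (complex \<times> complex) set" where
  "link f g \<epsilon> = {z \<in> sphere 0 \<epsilon>. eval2 f z * eval2 g z = 0}"

definition milnor_product_map ::
    "complex poly poly \<Rightarrow> complex poly poly \<Rightarrow> complex \<times> complex \<Rightarrow> complex \<times> complex" where
  "milnor_product_map f g z =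
     (eval2 f z / complex_of_real (cmod (eval2 f z)), eval2 g z / complex_of_real (cmod (eval2 g z)))"

definition sphere_tangent_space :: "complex \<times> complex \<Rightarrow> (complex \<times> complex) set" where
  "sphere_tangent_space p = {v. v \<bullet> p = 0}"

text \<open>
  The formula for \<open>\<Phi>\<close> is smooth on the open set where \<open>f * g \<noteq> 0\<close>, so the differential at \<open>p\<close> of its
  restriction to the sphere is the real Frechet derivative of the formula, restricted to the tangent
  space of the sphere. Its rank is the real dimension of the image; viewing the values in
  \<open>\<complex> \<times> \<complex>\<close> instead of the torus does not change it.
\<close>

definition milnor_rank :: "complex poly poly \<Rightarrow> complex poly poly \<Rightarrow> complex \<times> complex \<Rightarrow> nat" where
  "milnor_rank f g p =
     dim (frechet_derivative (milnor_product_map f g) (at p) ` sphere_tangent_space p)"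

definition singular_point_set ::
    "complex poly poly \<Rightarrow> complex poly poly \<Rightarrow> real \<Rightarrow> (complex \<times> complex) set" where
  "singular_point_set f g \<epsilon> = {p \<in> sphere 0 \<epsilon> - link f g \<epsilon>. milnor_rank f g p < 2}"

text \<open>
  Finitely many compact connected components are clopen, so such a set is also
  topologically the disjoint union of its components. The case of no circles is the empty set.
\<close>

definition at_most_circle_components :: "nat \<Rightarrow> 'a::topological_space set \<Rightarrow> bool" where
  "at_most_circle_components N X \<longleftrightarrow>
     finite (components X) \<and> card (components X) \<le> N \<and>
     (\<forall>C \<in> components X. C homeomorphic sphere (0::complex) 1)"

end

theory Submission
  imports Defs
begin

text \<open>
  Where \<open>f g \<noteq> 0\<close>, the differential of \<open>\<Phi>\<close> is given by the two real functionals \<open>v \<mapsto> Im (df v / f)\<close> and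
  \<open>v \<mapsto> Im (dg v / g)\<close>. With \<open>m = deg f\<close> and \<open>n = deg g\<close>, Euler's identity makes the complex
  functional \<open>n df / f - m dg / g\<close> vanish at \<open>z\<close>; it equals \<open>J / (f g) \<cdot> (z\<^sub>2 dz\<^sub>1 - z\<^sub>1 dz\<^sub>2)\<close>, where \<open>J\<close>
  is the Jacobian determinant of \<open>(f, g)\<close>. The tangent vectors \<open>\<i> z\<close> and multiples of
  \<open>(cnj z\<^sub>2, - cnj z\<^sub>1)\<close> then show that the rank drops exactly where \<open>J = 0\<close>. As \<open>J\<close> is a binary form of
  degree \<open>m + n - 2\<close>, it is zero or vanishes on at most \<open>m + n - 2\<close> complex lines, each of which
  meets the sphere in a circle lying either inside or outside the link.
\<close>

section \<open>Binary forms, their partial derivatives and Euler's identity\<close>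

text \<open>For \<open>degree p \<le> N\<close> this is the form \<open>y ^ N * p (x / y)\<close>,
  stored as its dehomogenization \<open>p\<close>. The degree \<open>N\<close> is kept apart because
  \<open>p\<close> has smaller degree when the form is divisible by \<open>y\<close>.\<close>

definition binary_form :: "nat \<Rightarrow> 'a::comm_semiring_1 poly \<Rightarrow> 'a \<times> 'a \<Rightarrow> 'a" where
  "binary_form N p z = (\<Sum>i\<le>N. coeff p i * fst z ^ i * snd z ^ (N - i))"

definition form_dx :: "nat \<Rightarrow> 'a::idom poly \<Rightarrow> 'a \<times> 'a \<Rightarrow> 'a" where
  "form_dx N p = binary_form (N - 1) (pderiv p)"

text \<open>Euler's identity, read at second coordinate 1, gives \<open>N p - t p'\<close> for the
  dehomogenized second partial derivative.\<close>

definition form_dy :: "nat \<Rightarrow> 'a::idom poly \<Rightarrow> 'a \<times> 'a \<Rightarrow> 'a" where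
  "form_dy N p = binary_form (N - 1) (smult (of_nat N) p - pCons 0 (pderiv p))"

lemma binary_form_snd_nonzero:
  fixes p :: "'a::field poly"
  assumes "degree p \<le> N" "y \<noteq> 0"
  shows "binary_form N p (x, y) = y ^ N * poly p (x / y)"
proof -
  have "poly p (x / y) = (\<Sum>i\<le>N. coeff p i * (x / y) ^ i)"
    unfolding poly_altdef using assms(1)
    by (intro sum.mono_neutral_left) (auto simp: coeff_eq_0)
  then show ?thesis
    using assms(2)
    by (auto simp: binary_form_def sum_distrib_left power_divide power_diff intro!: sum.cong)
qed

lemma binary_form_snd_zero:
  "binary_form N p (x, 0) = coeff p N * x ^ N"
proof -
  have "binary_form N p (x, 0) = (\<Sum>i\<le>N. if i = N then coeff p N * x ^ N else 0)"
    unfolding binary_form_def by (intro sum.cong) (auto simp: power_0_left)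
  then show ?thesis by simp
qed

lemma binary_form_scale:
  "binary_form N p (c * x, c * y) = c ^ N * binary_form N p (x, y)"
proof -
  have "coeff p i * (c * x) ^ i * (c * y) ^ (N - i) = c ^ N * (coeff p i * x ^ i * y ^ (N - i))"
    if "i \<le> N" for i
  proof -
    have "c ^ N = c ^ i * c ^ (N - i)" using that by (simp flip: power_add)
    then show ?thesis by (simp add: power_mult_distrib mult_ac)
  qed
  then show ?thesis
    unfolding binary_form_def sum_distrib_left by (intro sum.cong) auto
qed

lemma binary_form_diff:
  fixes p q :: "'a::comm_ring_1 poly"
  shows "binary_form N (p - q) z = binary_form N p z - binary_form N q z"
  by (simp add: binary_form_def sum_subtractf algebra_simps)

text \<open>Away from \<open>y = 0\<close>, multiplicativity of evaluation suffices. On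
  \<open>y = 0\<close> a form sees only its top coefficient, so there the top coefficient of the
  product decides.\<close>

lemma binary_form_mult:
  fixes p q :: "'a::field poly"
  assumes "degree p \<le> M" "degree q \<le> N"
  shows "binary_form (M + N) (p * q) z = binary_form M p z * binary_form N q z"
proof (cases z)
  case (Pair x y)
  have deg: "degree (p * q) \<le> M + N"
    using degree_mult_le[of p q] assms by linarith
  have "coeff (p * q) (M + N) = (\<Sum>i\<le>M + N. if i = M then coeff p M * coeff q N else 0)"
    unfolding coeff_mult
  proof (intro sum.cong)
    fix i assume "i \<in> {..M + N}"
    \<comment> \<open>For \<open>i < M\<close> the complementary index exceeds \<open>N\<close>; for
      \<open>i > M\<close> already \<open>i\<close> lies beyond the degree of
      \<open>p\<close>.\<close>
    then have "i \<noteq> M \<Longrightarrow> degree p < i \<or> degree q < M + N - i"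
      using assms by auto
    then show "coeff p i * coeff q (M + N - i) = (if i = M then coeff p M * coeff q N else 0)"
      by (auto simp: coeff_eq_0)
  qed simp
  then have top: "coeff (p * q) (M + N) = coeff p M * coeff q N" by simp
  show ?thesis
    using assms deg top unfolding Pair
    by (cases "y = 0") (simp_all add: binary_form_snd_zero binary_form_snd_nonzero power_add)
qed

lemma degree_pderiv_le_diff: "degree p \<le> N \<Longrightarrow> degree (pderiv p) \<le> N - 1"
  for p :: "'a::idom poly"
  by (rule degree_le) (auto simp: coeff_pderiv coeff_eq_0)

lemma coeff_dy_coeffs: "coeff (smult (of_nat N) p - pCons 0 (pderiv p)) i = (of_nat N - of_nat i) * coeff p i"
  for p :: "'a::idom poly"
  by (cases i) (auto simp: coeff_pderiv algebra_simps)

lemma degree_dy_coeffs: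
  fixes p :: "'a::idom poly"
  assumes "degree p \<le> N"
  shows "degree (smult (of_nat N) p - pCons 0 (pderiv p)) \<le> N - 1"
proof (rule degree_le, intro allI impI)
  fix i assume "i > N - 1"
  \<comment> \<open>The index \<open>N\<close> is settled by the factor \<open>N - i\<close> of
    \<open>coeff_dy_coeffs\<close>; this is what lowers the degree by one.\<close>
  then have "i = N \<or> i > degree p" using assms by linarith
  then show "coeff (smult (of_nat N) p - pCons 0 (pderiv p)) i = 0"
    unfolding coeff_dy_coeffs by (auto simp: coeff_eq_0)
qed

text \<open>With the same index range as the form itself, Euler's identity and the differential can
  be checked monomial by monomial. The summand at \<open>i = 0\<close>, where \<open>i - 1\<close>
  truncates, carries the factor 0.\<close>

lemma form_dx_eq_sum:
  assumes "N > 0"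
  shows "form_dx N p z = (\<Sum>i\<le>N. coeff p i * (of_nat i * fst z ^ (i - 1)) * snd z ^ (N - i))"
proof -
  obtain M where N: "N = Suc M" using assms by (cases N) auto
  show ?thesis
    unfolding N form_dx_def binary_form_def sum.atMost_Suc_shift
    by (auto simp: coeff_pderiv algebra_simps intro!: sum.cong)
qed

lemma form_dy_eq_sum:
  assumes "N > 0"
  shows "form_dy N p z = (\<Sum>i\<le>N. coeff p i * fst z ^ i * (of_nat (N - i) * snd z ^ (N - i - 1)))"
proof -
  obtain M where N: "N = Suc M" using assms by (cases N) auto
  show ?thesis
    unfolding N form_dy_def binary_form_def sum.atMost_Suc coeff_dy_coeffs
    by (auto simp: of_nat_diff algebra_simps intro!: sum.cong)
qed

lemma binary_form_euler:
  assumes "N > 0"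
  shows "fst z * form_dx N p z + snd z * form_dy N p z = of_nat N * binary_form N p z"
proof -
  have pow: "u * (of_nat k * u ^ (k - 1)) = of_nat k * u ^ k" for u :: 'a and k
    by (cases k) (auto simp: algebra_simps)
  have *: "fst z * (coeff p i * (of_nat i * fst z ^ (i - 1)) * snd z ^ (N - i)) +
      snd z * (coeff p i * fst z ^ i * (of_nat (N - i) * snd z ^ (N - i - 1))) =
      of_nat N * (coeff p i * fst z ^ i * snd z ^ (N - i))" if "i \<le> N" for i
  proof -
    have "?thesis \<longleftrightarrow> coeff p i * (fst z * (of_nat i * fst z ^ (i - 1))) * snd z ^ (N - i) +
      coeff p i * fst z ^ i * (snd z * (of_nat (N - i) * snd z ^ (N - i - 1))) =
      of_nat N * (coeff p i * fst z ^ i * snd z ^ (N - i))"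
      by (simp add: algebra_simps)
    also have "\<dots>" unfolding pow using that by (simp add: of_nat_diff algebra_simps)
    finally show ?thesis by simp
  qed
  show ?thesis
    unfolding form_dx_eq_sum[OF assms] form_dy_eq_sum[OF assms] binary_form_def sum_distrib_left
      sum.distrib[symmetric]
    by (intro sum.cong) (use * in auto)
qed

lemma has_derivative_binary_form:
  fixes p :: "'a::real_normed_field poly"
  assumes "N > 0"
  shows "(binary_form N p has_derivative
    (\<lambda>v. fst v * form_dx N p z + snd v * form_dy N p z)) (at z)"
proof -
  have "((\<lambda>z. \<Sum>i\<le>N. coeff p i * fst z ^ i * snd z ^ (N - i)) has_derivative
    (\<lambda>v. \<Sum>i\<le>N. fst v * (coeff p i * (of_nat i * fst z ^ (i - 1)) * snd z ^ (N - i)) +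
      snd v * (coeff p i * fst z ^ i * (of_nat (N - i) * snd z ^ (N - i - 1))))) (at z)"
    by (rule has_derivative_sum) (auto intro!: derivative_eq_intros simp: algebra_simps)
  then show ?thesis
    unfolding form_dx_eq_sum[OF assms] form_dy_eq_sum[OF assms] sum_distrib_left
      sum.distrib[symmetric] binary_form_def[abs_def] .
qed

section \<open>From homogeneous polynomials to binary forms\<close>

lemma homogeneous_eval2:
  assumes "homogeneous f" "total_degree f > 0"
  obtains p where "degree p \<le> total_degree f" "eval2 f = binary_form (total_degree f) p"
proof -
  obtain d where d: "\<And>i j. coeff (coeff f j) i \<noteq> 0 \<Longrightarrow> i + j = d"
    using assms(1) unfolding homogeneous_def by blast
  \<comment> \<open>The maximum defining the total degree is thus 0 or \<open>d\<close>, and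
    positivity selects \<open>d\<close>.\<close>
  have sub: "insert 0 {i + j | i j. coeff (coeff f j) i \<noteq> 0} \<subseteq> {0, d}" using d by auto
  then have "total_degree f \<in> {0, d}"
    unfolding total_degree_def
    by (meson Max_in finite.simps finite_subset insert_not_empty subsetD)
  then have td: "total_degree f = d" using assms(2) by auto
  define a where "a j = coeff (coeff f j) (d - j)" for j
  have monom: "coeff f j = (if j \<le> d then monom (a j) (d - j) else 0)" for j
    by (auto simp: poly_eq_iff a_def dest: d) (use d in fastforce)+
  \<comment> \<open>This is \<open>f (t, 1)\<close>; the indices are reversed because
    \<open>a\<close> is indexed by the exponent of the second variable and \<open>p\<close> by that
    of the first.\<close>
  define p where "p = (\<Sum>i\<le>d. monom (a (d - i)) i)"
  have cp: "coeff p i = (if i \<le> d then a (d - i) else 0)" for i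
    unfolding p_def by (simp add: coeff_sum)
  have "degree p \<le> d" by (rule degree_le) (auto simp: cp)
  moreover have "eval2 f z = binary_form d p z" for z
  proof -
    have "degree f \<le> d" by (rule degree_le) (auto simp: monom)
    then have "poly f [:snd z:] = (\<Sum>j\<le>d. coeff f j * [:snd z:] ^ j)"
      unfolding poly_altdef by (intro sum.mono_neutral_left) (auto simp: coeff_eq_0)
    then have "eval2 f z = (\<Sum>j\<le>d. a j * fst z ^ (d - j) * snd z ^ j)"
      unfolding eval2_def by (simp add: poly_sum monom poly_monom)
    also have "\<dots> = (\<Sum>i\<le>d. a (d - i) * fst z ^ i * snd z ^ (d - i))"
      by (rule sum.reindex_bij_witness[of _ "\<lambda>i. d - i" "\<lambda>i. d - i"]) auto
    finally show ?thesis by (simp add: binary_form_def cp)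
  qed
  ultimately show ?thesis using that[of p] td by (simp add: fun_eq_iff del: split_paired_All)
qed

section \<open>The differential of the product map and its rank\<close>

text \<open>Locally \<open>h / |h|\<close> is the exponential of \<open>\<i>\<close> times the
  argument of \<open>h\<close>, and the differential of the argument is the imaginary part of the
  logarithmic derivative.\<close>

lemma has_derivative_normalized:
  fixes h :: "'a::real_normed_vector \<Rightarrow> complex"
  assumes h: "(h has_derivative h') (at z)" and nz: "h z \<noteq> 0"
  shows "((\<lambda>z. h z / of_real (cmod (h z))) has_derivative
    (\<lambda>v. \<i> * (h z / of_real (cmod (h z))) * of_real (Im (h' v / h z)))) (at z)"
proof -
  have n: "((\<lambda>z. cmod (h z)) has_derivative (\<lambda>v. h' v \<bullet> sgn (h z))) (at z)"
    using has_derivative_compose[OF h has_derivative_norm[OF nz]] .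
  have D: "((\<lambda>z. h z / of_real (cmod (h z))) has_derivative
    (\<lambda>v. (h' v * of_real (cmod (h z)) - h z * of_real (h' v \<bullet> sgn (h z))) /
      (of_real (cmod (h z)) * of_real (cmod (h z))))) (at z)"
    by (rule has_derivative_divide'[OF h has_derivative_of_real[OF n]]) (use nz in auto)
  have "(h' v * of_real (cmod (h z)) - h z * of_real (h' v \<bullet> sgn (h z))) /
      (of_real (cmod (h z)) * of_real (cmod (h z))) =
     \<i> * (h z / of_real (cmod (h z))) * of_real (Im (h' v / h z))" for v
  proof -
    define w where "w = h' v / h z"
    define r where "r = cmod (h z)"
    have r: "r > 0" "complex_of_real r \<noteq> 0" using nz by (auto simp: r_def)
    have hv: "h' v = h z * w" using nz by (simp add: w_def)
    have "h' v \<bullet> sgn (h z) = Re (h' v * cnj (sgn (h z)))"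
      by (simp add: inner_complex_def)
    also have "h' v * cnj (sgn (h z)) = (h z * cnj (h z)) * w / of_real r"
      by (simp add: hv sgn_eq r_def)
    also have "\<dots> = of_real r * w"
      using r by (simp add: r_def power2_eq_square flip: complex_norm_square)
    \<comment> \<open>The modulus has derivative \<open>r * Re w\<close>; subtracting this radial
      part leaves only \<open>Im w\<close>.\<close>
    finally have i: "h' v \<bullet> sgn (h z) = r * Re w" by simp
    have w: "w - of_real (Re w) = \<i> * of_real (Im w)" by (simp add: complex_eq_iff)
    have "(h z * w * of_real r - h z * of_real (r * Re w)) / (of_real r * of_real r) =
      h z / of_real r * (w - of_real (Re w))" using r by (simp add: field_simps)
    also have "\<dots> = \<i> * (h z / of_real r) * of_real (Im w)" unfolding w by simp
    finally show ?thesis by (simp add: i hv[symmetric] flip: r_def w_def)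
  qed
  with D show ?thesis by simp
qed

text \<open>Linear algebra at one point: \<open>A\<close> and \<open>B\<close> stand for df / f and
  dg / g, and \<open>Az\<close>, \<open>Bz\<close> are Euler's identity. The image always contains
  the nonzero vector \<open>e\<close>, so the rank is below 2 exactly when the image lies on the
  real line through \<open>e\<close>.\<close>

lemma dim_torus_differential:
  fixes u w a\<^sub>1 a\<^sub>2 b\<^sub>1 b\<^sub>2 :: complex and z :: "complex \<times> complex" and m n :: real
  defines "A v \<equiv> fst v * a\<^sub>1 + snd v * a\<^sub>2" and "B v \<equiv> fst v * b\<^sub>1 + snd v * b\<^sub>2"
  defines "D v \<equiv> (\<i> * u * of_real (Im (A v)), \<i> * w * of_real (Im (B v)))"
  assumes u: "u \<noteq> 0" and w: "w \<noteq> 0" and m: "m > 0" and n: "n > 0"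
    and Az: "A z = of_real m" and Bz: "B z = of_real n"
  shows "dim (D ` {v. v \<bullet> z = 0}) < 2 \<longleftrightarrow> a\<^sub>1 * b\<^sub>2 = a\<^sub>2 * b\<^sub>1"
proof -
  define det where "det = a\<^sub>1 * b\<^sub>2 - a\<^sub>2 * b\<^sub>1"
  obtain x y where z: "z = (x, y)" by (cases z)
  \<comment> \<open>Once \<open>n\<close> and \<open>m\<close> are replaced by \<open>B z\<close>
    and \<open>A z\<close>, the terms with \<open>x\<close> cancel in the first identity and those
    with \<open>y\<close> in the second.\<close>
  have c1: "of_real n * a\<^sub>1 - of_real m * b\<^sub>1 = y * det"
    and c2: "of_real n * a\<^sub>2 - of_real m * b\<^sub>2 = - (x * det)"
    unfolding Az[symmetric] Bz[symmetric] by (simp_all add: A_def B_def z det_def algebra_simps)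
  have AB: "of_real n * A v - of_real m * B v = det * (fst v * y - snd v * x)" for v
  proof -
    have "of_real n * A v - of_real m * B v =
      fst v * (of_real n * a\<^sub>1 - of_real m * b\<^sub>1) + snd v * (of_real n * a\<^sub>2 - of_real m * b\<^sub>2)"
      by (simp add: A_def B_def algebra_simps)
    then show ?thesis unfolding c1 c2 by (simp add: algebra_simps)
  qed
  \<comment> \<open>The image of the tangent vector \<open>\<i> z\<close>.\<close>
  define e where "e = (\<i> * u * of_real m, \<i> * w * of_real n)"
  show ?thesis
  proof
    assume "a\<^sub>1 * b\<^sub>2 = a\<^sub>2 * b\<^sub>1"
    then have "det = 0" by (simp add: det_def)
    have "D v \<in> span {e}" for v
    proof -
      have "n * Im (A v) = m * Im (B v)"
        using arg_cong[OF AB[of v], of Im] \<open>det = 0\<close> by simp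
      then have "D v = (Im (A v) / m) *\<^sub>R e"
        using m by (simp add: D_def e_def scaleR_conv_of_real field_simps flip: of_real_mult)
      then show ?thesis by (auto simp: span_singleton)
    qed
    then have "dim (D ` {v. v \<bullet> z = 0}) \<le> card {e}" by (intro dim_le_card) auto
    then show "dim (D ` {v. v \<bullet> z = 0}) < 2" by simp
  next
    assume dim: "dim (D ` {v. v \<bullet> z = 0}) < 2"
    show "a\<^sub>1 * b\<^sub>2 = a\<^sub>2 * b\<^sub>1"
    proof (rule ccontr)
      assume "a\<^sub>1 * b\<^sub>2 \<noteq> a\<^sub>2 * b\<^sub>1"
      then have det: "det \<noteq> 0" by (simp add: det_def)
      define v\<^sub>1 where "v\<^sub>1 = (\<i> * x, \<i> * y)"
      \<comment> \<open>Every complex multiple of \<open>(cnj y, - cnj x)\<close> is tangent, being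
        Hermitian orthogonal to \<open>z\<close>. This factor turns \<open>n A - m B\<close> into
        \<open>\<i>\<close> times the squared norm of \<open>z\<close>, so the imaginary parts of
        \<open>A\<close> and \<open>B\<close> are not in the ratio \<open>m : n\<close>, as they are
        along \<open>e\<close>.\<close>
      define l where "l = \<i> / det"
      define v\<^sub>2 where "v\<^sub>2 = (l * cnj y, - (l * cnj x))"
      have "A v\<^sub>1 = \<i> * A z" "B v\<^sub>1 = \<i> * B z"
        by (simp_all add: A_def B_def v\<^sub>1_def z algebra_simps)
      then have Dv\<^sub>1: "D v\<^sub>1 = e" by (simp add: D_def e_def Az Bz)
      have t\<^sub>1: "v\<^sub>1 \<bullet> z = 0" by (simp add: v\<^sub>1_def z inner_complex_def algebra_simps)
      have t\<^sub>2: "v\<^sub>2 \<bullet> z = 0" by (simp add: v\<^sub>2_def z inner_complex_def algebra_simps)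
      have "of_real n * A v\<^sub>2 - of_real m * B v\<^sub>2 = \<i> * (x * cnj x + y * cnj y)"
        unfolding AB using det by (simp add: v\<^sub>2_def l_def algebra_simps)
      also have "\<dots> = \<i> * of_real ((cmod x)\<^sup>2 + (cmod y)\<^sup>2)"
        by (simp only: complex_norm_square of_real_add)
      finally have "n * Im (A v\<^sub>2) - m * Im (B v\<^sub>2) = (cmod x)\<^sup>2 + (cmod y)\<^sup>2"
        by (simp add: complex_eq_iff)
      moreover have "z \<noteq> 0" using Az m by (auto simp: A_def)
      then have "(cmod x)\<^sup>2 + (cmod y)\<^sup>2 \<noteq> 0" by (auto simp: z zero_prod_def sum_power2_eq_zero_iff)
      ultimately have ne: "n * Im (A v\<^sub>2) \<noteq> m * Im (B v\<^sub>2)" by (metis diff_self)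
      have "D v\<^sub>2 \<notin> span {e}"
      proof
        assume "D v\<^sub>2 \<in> span {e}"
        then obtain k where "D v\<^sub>2 = k *\<^sub>R e" by (auto simp: span_singleton)
        then have "\<i> * u * of_real (Im (A v\<^sub>2)) = \<i> * u * of_real (k * m)"
          "\<i> * w * of_real (Im (B v\<^sub>2)) = \<i> * w * of_real (k * n)"
          by (auto simp: D_def e_def scaleR_conv_of_real)
        then have "Im (A v\<^sub>2) = k * m" "Im (B v\<^sub>2) = k * n"
          using u w by (auto simp del: of_real_mult)
        then show False using ne by simp
      qed
      moreover have "e \<noteq> 0" using u m by (auto simp: e_def zero_prod_def)
      ultimately have "independent {D v\<^sub>2, e}"
        by (intro independent_insertI) (simp_all add: independent_empty)
      moreover have "D v\<^sub>2 \<noteq> e" using \<open>D v\<^sub>2 \<notin> span {e}\<close> by (auto intro: span_base)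
      moreover have "{D v\<^sub>2, e} \<subseteq> D ` {v. v \<bullet> z = 0}"
        using t\<^sub>1 t\<^sub>2 Dv\<^sub>1[symmetric] by auto
      ultimately have "card {D v\<^sub>2, e} \<le> dim (D ` {v. v \<bullet> z = 0})"
        by (intro independent_card_le_dim)
      with dim \<open>D v\<^sub>2 \<noteq> e\<close> show False by simp
    qed
  qed
qed

lemma milnor_rank_less_2_iff:
  fixes p q :: "complex poly"
  assumes f: "eval2 f = binary_form m p" and g: "eval2 g = binary_form n q"
    and m: "m > 0" and n: "n > 0" and fz: "eval2 f z \<noteq> 0" and gz: "eval2 g z \<noteq> 0"
  shows "milnor_rank f g z < 2 \<longleftrightarrow> form_dx m p z * form_dy n q z = form_dy m p z * form_dx n q z"
proof -
  let ?f = "eval2 f z" and ?g = "eval2 g z"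
  have df: "(eval2 f has_derivative (\<lambda>v. fst v * form_dx m p z + snd v * form_dy m p z)) (at z)"
    unfolding f by (rule has_derivative_binary_form[OF m])
  have dg: "(eval2 g has_derivative (\<lambda>v. fst v * form_dx n q z + snd v * form_dy n q z)) (at z)"
    unfolding g by (rule has_derivative_binary_form[OF n])
  let ?D = "\<lambda>v.
    (\<i> * (?f / of_real (cmod ?f)) *
       of_real (Im (fst v * (form_dx m p z / ?f) + snd v * (form_dy m p z / ?f))),
     \<i> * (?g / of_real (cmod ?g)) *
       of_real (Im (fst v * (form_dx n q z / ?g) + snd v * (form_dy n q z / ?g))))"
  have "(milnor_product_map f g has_derivative ?D) (at z)"
    unfolding milnor_product_map_def[abs_def]
    using has_derivative_Pair[OF has_derivative_normalized[OF df fz] has_derivative_normalized[OF dg gz]]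
    by (simp add: add_divide_distrib)
  then have "frechet_derivative (milnor_product_map f g) (at z) = ?D"
    by (rule frechet_derivative_at[symmetric])
  then have "milnor_rank f g z < 2 \<longleftrightarrow> dim (?D ` {v. v \<bullet> z = 0}) < 2"
    by (simp add: milnor_rank_def sphere_tangent_space_def)
  also have "\<dots> \<longleftrightarrow>
    form_dx m p z / ?f * (form_dy n q z / ?g) = form_dy m p z / ?f * (form_dx n q z / ?g)"
  proof (rule dim_torus_differential[where m = "of_nat m" and n = "of_nat n"])
    show "fst z * (form_dx m p z / ?f) + snd z * (form_dy m p z / ?f) = of_real (of_nat m)"
      using binary_form_euler[OF m, of z p] fz by (simp add: f field_simps)
    show "fst z * (form_dx n q z / ?g) + snd z * (form_dy n q z / ?g) = of_real (of_nat n)"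
      using binary_form_euler[OF n, of z q] gz by (simp add: g field_simps)
  qed (use fz gz m n in auto)
  also have "\<dots> \<longleftrightarrow> form_dx m p z * form_dy n q z = form_dy m p z * form_dx n q z"
    using fz gz by (simp add: field_simps)
  finally show ?thesis .
qed

section \<open>The Jacobian form and roots on the projective line\<close>

lemma form_jacobian:
  fixes p q :: "'a::field poly"
  assumes "degree p \<le> m" "degree q \<le> n" "m > 0" "n > 0"
  obtains P where "degree P \<le> m + n - 2"
    "\<And>z. form_dx m p z * form_dy n q z - form_dy m p z * form_dx n q z = binary_form (m + n - 2) P z"
proof -
  define p\<^sub>x p\<^sub>y where "p\<^sub>x = pderiv p" and "p\<^sub>y = smult (of_nat m) p - pCons 0 (pderiv p)"
  define q\<^sub>x q\<^sub>y where "q\<^sub>x = pderiv q" and "q\<^sub>y = smult (of_nat n) q - pCons 0 (pderiv q)"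
  have deg: "degree p\<^sub>x \<le> m - 1" "degree p\<^sub>y \<le> m - 1" "degree q\<^sub>x \<le> n - 1" "degree q\<^sub>y \<le> n - 1"
    unfolding p\<^sub>x_def p\<^sub>y_def q\<^sub>x_def q\<^sub>y_def using assms by (simp_all only: degree_pderiv_le_diff degree_dy_coeffs)
  \<comment> \<open>Positivity of \<open>m\<close> and \<open>n\<close> keeps the truncated
    subtractions exact.\<close>
  have N: "m + n - 2 = (m - 1) + (n - 1)" using assms by simp
  show ?thesis
  proof
    show "degree (p\<^sub>x * q\<^sub>y - p\<^sub>y * q\<^sub>x) \<le> m + n - 2"
      using degree_mult_le[of p\<^sub>x q\<^sub>y] degree_mult_le[of p\<^sub>y q\<^sub>x] deg unfolding N
      by (intro degree_diff_le) linarith+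
    show "form_dx m p z * form_dy n q z - form_dy m p z * form_dx n q z =
      binary_form (m + n - 2) (p\<^sub>x * q\<^sub>y - p\<^sub>y * q\<^sub>x) z" for z
      unfolding N using deg
      unfolding form_dx_def form_dy_def p\<^sub>y_def[symmetric] q\<^sub>y_def[symmetric]
      unfolding p\<^sub>x_def[symmetric] q\<^sub>x_def[symmetric]
      by (simp add: binary_form_diff binary_form_mult)
  qed
qed

text \<open>
  The roots on the projective line, each represented by a point \<open>(t, 1)\<close> or \<open>(1, 0)\<close>; the degree
  bound \<open>N\<close> decides whether infinity is a root.
\<close>

definition projective_roots :: "nat \<Rightarrow> 'a::field poly \<Rightarrow> ('a \<times> 'a) set" where
  "projective_roots N p =
    (\<lambda>t. (t, 1)) ` {t. poly p t = 0} \<union> (if coeff p N = 0 then {(1, 0)} else {})"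

lemma finite_projective_roots:
  assumes "p \<noteq> 0"
  shows "finite (projective_roots N p)"
  using assms by (simp add: projective_roots_def poly_roots_finite)

lemma card_projective_roots:
  fixes p :: "'a::field poly"
  assumes "p \<noteq> 0" "degree p \<le> N"
  shows "card (projective_roots N p) \<le> N"
proof -
  let ?S = "(\<lambda>t. (t, 1 :: 'a)) ` {t. poly p t = 0}"
  have "card ?S \<le> degree p"
    using card_image_le[OF poly_roots_finite[OF assms(1)]] card_poly_roots_bound[OF assms(1)]
    by (rule order_trans)
  \<comment> \<open>A root at infinity costs one degree, so the affine roots leave room for it in
    the bound \<open>N\<close>.\<close>
  moreover have "degree p < N" if "coeff p N = 0"
    using that assms leading_coeff_0_iff[of p] by (metis le_neq_implies_less)
  ultimately show ?thesis
    unfolding projective_roots_def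
    using card_Un_le[of ?S "{(1, 0)}"] assms(2) by auto
qed

text \<open>For \<open>y = 0\<close> the point lies on the line at infinity \<open>(1, 0)\<close>;
  otherwise \<open>x / y\<close> is its affine coordinate. The origin is excluded since
  \<open>c = 0\<close> is allowed on the right.\<close>

lemma binary_form_eq_0_iff:
  assumes "degree p \<le> N" "z \<noteq> 0"
  shows "binary_form N p z = 0 \<longleftrightarrow> (\<exists>r \<in> projective_roots N p. \<exists>c. z = (c * fst r, c * snd r))"
proof (cases z)
  case (Pair x y)
  show ?thesis
  proof (cases "y = 0")
    case True
    then show ?thesis using assms
      by (auto simp: Pair projective_roots_def binary_form_snd_zero zero_prod_def split: if_splits)
  next
    case False
    then have "(\<exists>r \<in> projective_roots N p. \<exists>c. z = (c * fst r, c * snd r)) \<longleftrightarrow> poly p (x / y) = 0"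
      by (force simp: Pair projective_roots_def split: if_splits)
    with False show ?thesis using assms by (simp add: Pair binary_form_snd_nonzero)
  qed
qed

text \<open>The representatives are normalized, one for each line, and distinct lines meet only at
  the origin. This makes the circles disjoint.\<close>

lemma projective_roots_unique:
  assumes "r \<in> projective_roots N p" "s \<in> projective_roots N p"
    and "(c * fst r, c * snd r) = (d * fst s, d * snd s)" "(c * fst r, c * snd r) \<noteq> 0"
  shows "r = s"
  using assms by (auto simp: projective_roots_def zero_prod_def split: if_splits)

section \<open>Circles as connected components\<close>

lemma components_finite_disjoint_Union:
  fixes \<C> :: "'a::topological_space set set"
  assumes fin: "finite \<C>" and disj: "disjoint \<C>"
    and \<C>: "\<And>C. C \<in> \<C> \<Longrightarrow> closed C \<and> connected C \<and> C \<noteq> {}"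
  shows "components (\<Union>\<C>) = \<C>"
proof -
  have comp: "connected_component_set (\<Union>\<C>) x = C" if C: "C \<in> \<C>" and x: "x \<in> C" for C x
  proof (rule connected_component_unique)
    fix K assume K: "x \<in> K" "K \<subseteq> \<Union>\<C>" "connected K"
    \<comment> \<open>By finiteness the remaining sets have a closed union, so a connected
      \<open>K\<close> meeting \<open>C\<close> cannot also meet them.\<close>
    have "closed (\<Union>(\<C> - {C}))" using fin \<C> by (intro closed_Union) auto
    moreover have "C \<inter> \<Union>(\<C> - {C}) = {}"
      using disj C by (auto simp: disjoint_def)
    moreover have "K \<subseteq> C \<union> \<Union>(\<C> - {C})" using K by auto
    ultimately have "\<Union>(\<C> - {C}) \<inter> K = {}"
      using connected_closedD[OF \<open>connected K\<close>, of C "\<Union>(\<C> - {C})"] \<C>[OF C] K x by blast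
    with \<open>K \<subseteq> C \<union> \<Union>(\<C> - {C})\<close> show "K \<subseteq> C" by blast
  qed (use C x \<C> in auto)
  show ?thesis
    unfolding components_def using comp \<C> by (force simp: image_iff)
qed

text \<open>The unit circle is mapped by \<open>c\<close> to \<open>k c r\<close>, with
  \<open>k\<close> correcting the norm; a continuous injection of a compact space into a Hausdorff
  space is a homeomorphism onto its image.\<close>

lemma homeomorphic_complex_line_sphere:
  fixes r :: "complex \<times> complex"
  assumes "r \<noteq> 0" "\<epsilon> > 0"
  shows "sphere (0::complex) 1 homeomorphic {z \<in> sphere 0 \<epsilon>. \<exists>c. z = (c * fst r, c * snd r)}"
proof -
  define k where "k = \<epsilon> / norm r"
  have k: "k > 0" using assms by (simp add: k_def)
  have norm: "norm (c * fst r, c * snd r) = cmod c * norm r" for c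
    by (simp add: norm_Pair norm_prod_def norm_mult power_mult_distrib real_sqrt_mult
        flip: distrib_left)
  let ?h = "\<lambda>c. (complex_of_real k * c * fst r, complex_of_real k * c * snd r)"
  show ?thesis
  proof (rule homeomorphic_compact)
    show "inj_on ?h (sphere 0 1)"
      using assms k by (auto simp: inj_on_def zero_prod_def prod_eq_iff)
    show "?h ` sphere 0 1 = {z \<in> sphere 0 \<epsilon>. \<exists>c. z = (c * fst r, c * snd r)}"
    proof (intro equalityI subsetI)
      fix z assume "z \<in> {z \<in> sphere 0 \<epsilon>. \<exists>c. z = (c * fst r, c * snd r)}"
      then obtain c where c: "z = (c * fst r, c * snd r)" "norm z = \<epsilon>" by auto
      then have "cmod c * norm r = \<epsilon>" using norm by simp
      then have "cmod (c / of_real k) = 1"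
        using k assms by (auto simp: norm_divide norm_mult k_def field_simps)
      then show "z \<in> ?h ` sphere 0 1"
        using c k by (intro image_eqI[of _ _ "c / of_real k"]) auto
    next
      fix z assume "z \<in> ?h ` sphere 0 1"
      then obtain c where "cmod c = 1" "z = ?h c" by auto
      moreover have "cmod (of_real k * c) * norm r = \<epsilon>"
        using \<open>cmod c = 1\<close> k assms by (simp add: norm_mult norm_divide k_def)
      ultimately show "z \<in> {z \<in> sphere 0 \<epsilon>. \<exists>c. z = (c * fst r, c * snd r)}"
        using norm[of "of_real k * c"] by auto
    qed
  qed (auto intro!: continuous_intros)
qed

text \<open>The predicate \<open>h\<close> stands for lying off the link. Being invariant under
  nonzero scaling, it is constant on each punctured complex line, so it keeps or discards whole
  circles; \<open>R\<close> collects the roots whose circles are kept.\<close>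

lemma at_most_circle_components_binary_form:
  assumes "P \<noteq> 0" "degree P \<le> N" "\<epsilon> > 0"
    and h: "\<And>c z. c \<noteq> 0 \<Longrightarrow> h (c * fst z, c * snd z) \<longleftrightarrow> h z"
  shows "at_most_circle_components N {z \<in> sphere 0 \<epsilon>. h z \<and> binary_form N P z = (0::complex)}"
proof -
  define R where "R = {r \<in> projective_roots N P. h r}"
  define circle where "circle r = {z \<in> sphere 0 \<epsilon>. \<exists>c. z = (c * fst r, c * snd r)}"
    for r :: "complex \<times> complex"
  have R_sub: "R \<subseteq> projective_roots N P" by (auto simp: R_def)
  have finR: "finite R" using finite_projective_roots[OF assms(1)] R_sub by (rule finite_subset[rotated])
  have R0: "r \<noteq> 0" if "r \<in> R" for r
    using that by (auto simp: R_def projective_roots_def zero_prod_def split: if_splits)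
  have "{z \<in> sphere 0 \<epsilon>. h z \<and> binary_form N P z = 0} = \<Union>(circle ` R)"
  proof -
    have *: "h z \<and> binary_form N P z = 0 \<longleftrightarrow> (\<exists>r\<in>R. \<exists>c. z = (c * fst r, c * snd r))"
      if "norm z = \<epsilon>" for z
    proof -
      have z: "z \<noteq> 0" using that assms by auto
      have "h z \<longleftrightarrow> h r" if "z = (c * fst r, c * snd r)" for c r
        using h[of c r] that z by (cases "c = 0") (auto simp: zero_prod_def)
      then show ?thesis unfolding binary_form_eq_0_iff[OF assms(2) z] R_def by blast
    qed
    show ?thesis
    proof (rule set_eqI)
      fix z :: "complex \<times> complex"
      show "z \<in> {z \<in> sphere 0 \<epsilon>. h z \<and> binary_form N P z = 0} \<longleftrightarrow> z \<in> \<Union>(circle ` R)"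
        using *[of z] by (cases "norm z = \<epsilon>") (simp_all add: circle_def)
    qed
  qed
  moreover have "components (\<Union>(circle ` R)) = circle ` R"
  proof (rule components_finite_disjoint_Union)
    show "disjoint (circle ` R)"
    proof (rule disjointI)
      fix A B assume "A \<in> circle ` R" "B \<in> circle ` R" "A \<noteq> B"
      then obtain r s where rs: "r \<in> R" "s \<in> R" "r \<noteq> s" "A = circle r" "B = circle s" by auto
      show "A \<inter> B = {}"
      proof (rule ccontr)
        assume "A \<inter> B \<noteq> {}"
        then obtain z where "z \<in> circle r" "z \<in> circle s" unfolding rs by blast
        then obtain c d where "z = (c * fst r, c * snd r)" "z = (d * fst s, d * snd s)" "norm z = \<epsilon>"
          by (auto simp: circle_def)
        then have "(c * fst r, c * snd r) = (d * fst s, d * snd s)"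
          "norm (c * fst r, c * snd r) = \<epsilon>" by simp_all
        then show False using projective_roots_unique[of r N P s c d] rs R_sub assms(3)
          by (metis less_irrefl norm_zero subsetD)
      qed
    qed
    fix C assume "C \<in> circle ` R"
    then obtain r where r: "r \<in> R" "C = circle r" by auto
    have hom: "sphere (0::complex) 1 homeomorphic C"
      unfolding r circle_def using homeomorphic_complex_line_sphere[OF R0[OF r(1)] assms(3)] .
    have "compact C" using homeomorphic_compactness[OF hom] by simp
    moreover have "connected C"
      using homeomorphic_connectedness[OF hom] connected_sphere[of "0::complex" 1] by simp
    moreover have "C \<noteq> {}" using hom by (auto simp: homeomorphic_empty)
    ultimately show "closed C \<and> connected C \<and> C \<noteq> {}" by (simp add: compact_imp_closed)
  qed (use finR in simp)
  moreover have "card (circle ` R) \<le> N"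
    using card_image_le[OF finR] card_mono[OF finite_projective_roots[OF assms(1)] R_sub]
      card_projective_roots[OF assms(1,2)] by (meson order_trans)
  ultimately show ?thesis
    unfolding at_most_circle_components_def
    using finR homeomorphic_complex_line_sphere[OF R0 assms(3)]
    by (auto simp: circle_def homeomorphic_sym[of _ "sphere (0::complex) 1"])
qed

section \<open>The dichotomy between zero and nonzero Jacobian\<close>

theorem proposition4p3:
  fixes f g :: "complex poly poly"
  assumes "homogeneous f" and "homogeneous g"
    and "total_degree f > 0" and "total_degree g > 0"
  shows "\<exists>\<epsilon>\<^sub>0>0. \<forall>\<epsilon>. 0 < \<epsilon> \<and> \<epsilon> \<le> \<epsilon>\<^sub>0 \<longrightarrow>
    at_most_circle_components (total_degree f + total_degree g - 2) (singular_point_set f g \<epsilon>) \<or>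
    singular_point_set f g \<epsilon> = sphere 0 \<epsilon> - link f g \<epsilon>"
proof -
  let ?m = "total_degree f" and ?n = "total_degree g"
  obtain p where p: "degree p \<le> ?m" "eval2 f = binary_form ?m p"
    using homogeneous_eval2 assms by blast
  obtain q where q: "degree q \<le> ?n" "eval2 g = binary_form ?n q"
    using homogeneous_eval2 assms by blast
  obtain P where P: "degree P \<le> ?m + ?n - 2"
    and J: "\<And>z. form_dx ?m p z * form_dy ?n q z - form_dy ?m p z * form_dx ?n q z =
      binary_form (?m + ?n - 2) P z"
    using form_jacobian[OF p(1) q(1) assms(3,4)] by blast
  have sing: "singular_point_set f g \<epsilon> =
    {z \<in> sphere 0 \<epsilon>. eval2 f z * eval2 g z \<noteq> 0 \<and> binary_form (?m + ?n - 2) P z = 0}" for \<epsilon>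
    using milnor_rank_less_2_iff[OF p(2) q(2) assms(3,4)]
    unfolding singular_point_set_def link_def J[symmetric] by auto
  have "at_most_circle_components (?m + ?n - 2) (singular_point_set f g \<epsilon>) \<or>
    singular_point_set f g \<epsilon> = sphere 0 \<epsilon> - link f g \<epsilon>" if "\<epsilon> > 0" for \<epsilon>
  proof (cases "P = 0")
    case True
    then have "singular_point_set f g \<epsilon> = sphere 0 \<epsilon> - link f g \<epsilon>"
      unfolding sing link_def by (auto simp: binary_form_def)
    then show ?thesis ..
  next
    case False
    have "at_most_circle_components (?m + ?n - 2) (singular_point_set f g \<epsilon>)"
      unfolding sing
      by (rule at_most_circle_components_binary_form[OF False P that])
        (simp add: p(2) q(2) binary_form_scale)
    then show ?thesis ..
  qed
  \<comment> \<open>The dichotomy holds at every positive radius, so the bound 1 is an arbitrary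
    choice.\<close>
  then show ?thesis by (intro exI[of _ 1]) auto
qed

end
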